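(* Let $\widetilde E\in\mathcal{E}^{\textsc{nest}}_{n,m,q}$ be a nested request sequence and define $E'=((N'_t,q'_t))_{t\in[n]}$ by $N'_t=\{t,t+1,\dots,n\}$ and $q'_t=\textsc{OPT}(\widetilde E)^{\uparrow}(t)$ (the $t$-th smallest entry of $\textsc{OPT}(\widetilde E)$). Then: (1) $E'\in\mathcal{E}^{\textsc{nest}}_{n,n,q}$ with $N'_t=\{t,\dots,n\}$; (2) $q'_1\le q'_2\le\cdots\le q'_n$ and $\sum_{t=1}^nq'_t=q$; (3) $\textsc{OPT}(\widetilde E)\sim\textsc{OPT}(E')$ and $\textsc{WF}(\widetilde E)\preceq\textsc{WF}(E')$.
   Context: Offline nodes are $[n]$. A request sequence is $E=((N_t,q_t))_{t\in[m]}$ with $N_t\subseteq[n]$ and quantities $q_t$; $\mathcal{E}_{n,m,q}$: such sequences with $\sum_tq_t=q$; $\mathcal{E}^{\textsc{nest}}_{n,m,q}$: those with $N_1\supseteq\cdots\supseteq N_m$. $\Delta(N,q)=\{x\in\mathbb{R}^n_{\ge0}: x(i)=0\ \forall i\notin N,\ \sum_ix(i)=q\}$, $\Delta(E)=\sum_t\Delta(N_t,q_t)$ (Minkowski sum). Majorization: for $x,y\in\mathbb{R}^n_{\ge0}$ with equal sums, $x\succeq y$ (i.e. $y\preceq x$) iff for every $j$ the sum of the $j$ largest entries of $x$ is at least that of $y$; $x\sim y$ iff both hold. $\textsc{OPT}(E)$ is the unique majorization-minimal element of $\Delta(E)$ (known to exist). Water-filling chooses, at arrival $t$, the unique $x_t\in\Delta(N_t,q_t)$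 maximizing $\min_{i\in N_t}(x_t(i)+\sum_{s<t}x_s(i))$; $\textsc{WF}(E)=\sum_tx_t$. *)

theory Defs
  imports Complex_Main "HOL-Library.Function_Algebras" "HOL-Library.Set_Algebras"
begin

text \<open>
  Vectors indexed by the offline nodes \<open>[n] = {1..n}\<close> are functions \<open>nat \<Rightarrow> real\<close>; every allocation
  vanishes outside \<open>{1..n}\<close>. The \<open>t\<close>-th request \<open>(N\<^sub>t, q\<^sub>t)\<close> of a sequence \<open>E\<close> is \<open>E ! (t - 1)\<close>.
\<close>

type_synonym request = "nat set \<times> real"

text \<open>
  The last two conditions on a request say exactly that it can be served, that is, that
  its set of allocations \<open>Delta n N d\<close> below is nonempty.
\<close>

definition requests :: "nat \<Rightarrow> nat \<Rightarrow> real \<Rightarrow> request list set" where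
  "requests n m q =
     {E. length E = m
       \<and> (\<forall>(N, d) \<in> set E. N \<subseteq> {1..n} \<and> 0 \<le> d \<and> (N = {} \<longrightarrow> d = 0))
       \<and> (\<Sum>(N, d)\<leftarrow>E. d) = q}"

definition nested_requests :: "nat \<Rightarrow> nat \<Rightarrow> real \<Rightarrow> request list set" where
  "nested_requests n m q = {E \<in> requests n m q. sorted_wrt (\<supseteq>) (map fst E)}"

definition Delta :: "nat \<Rightarrow> nat set \<Rightarrow> real \<Rightarrow> (nat \<Rightarrow> real) set" where
  "Delta n N d = {x. (\<forall>i. 0 \<le> x i) \<and> (\<forall>i. i \<notin> N \<longrightarrow> x i = 0) \<and> (\<Sum>i=1..n. x i) = d}"

text \<open>Addition of sets is the Minkowski sum, with \<open>{0}\<close> as the empty sum.\<close>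

definition Delta_seq :: "nat \<Rightarrow> request list \<Rightarrow> (nat \<Rightarrow> real) set" where
  "Delta_seq n E = (\<Sum>(N, d)\<leftarrow>E. Delta n N d)"

definition ascending :: "nat \<Rightarrow> (nat \<Rightarrow> real) \<Rightarrow> real list" where
  "ascending n x = sort (map x [1..<Suc n])"

definition top_sum :: "nat \<Rightarrow> nat \<Rightarrow> (nat \<Rightarrow> real) \<Rightarrow> real" where
  "top_sum n j x = sum_list (take j (rev (ascending n x)))"

definition majorizes :: "nat \<Rightarrow> (nat \<Rightarrow> real) \<Rightarrow> (nat \<Rightarrow> real) \<Rightarrow> bool" where
  "majorizes n x y \<longleftrightarrow>
     (\<forall>i\<in>{1..n}. 0 \<le> x i \<and> 0 \<le> y i) \<and> (\<Sum>i=1..n. x i) = (\<Sum>i=1..n. y i)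
     \<and> (\<forall>j\<in>{1..n}. top_sum n j x \<ge> top_sum n j y)"

definition maj_equiv :: "nat \<Rightarrow> (nat \<Rightarrow> real) \<Rightarrow> (nat \<Rightarrow> real) \<Rightarrow> bool" where
  "maj_equiv n x y \<longleftrightarrow> majorizes n x y \<and> majorizes n y x"

definition maj_minimal :: "nat \<Rightarrow> (nat \<Rightarrow> real) set \<Rightarrow> (nat \<Rightarrow> real) \<Rightarrow> bool" where
  "maj_minimal n S x \<longleftrightarrow> x \<in> S \<and> (\<forall>y\<in>S. majorizes n x y \<longrightarrow> majorizes n y x)"

definition OPT :: "nat \<Rightarrow> request list \<Rightarrow> nat \<Rightarrow> real" where
  "OPT n E = (THE x. maj_minimal n (Delta_seq n E) x)"

text \<open>
  The step depends on the past only through the accumulated load \<open>w\<close>. For \<open>N = {}\<close> (and then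
  \<open>d = 0\<close>) the minimum is over the empty set, hence a constant, and the unique maximizer is \<open>0\<close>.
\<close>

definition WF_step :: "nat \<Rightarrow> (nat \<Rightarrow> real) \<Rightarrow> request \<Rightarrow> nat \<Rightarrow> real" where
  "WF_step n w = (\<lambda>(N, d).
     THE x. is_arg_max (\<lambda>x. MIN i\<in>N. x i + w i) (\<lambda>x. x \<in> Delta n N d) x)"

definition WF :: "nat \<Rightarrow> request list \<Rightarrow> nat \<Rightarrow> real" where
  "WF n E = foldl (\<lambda>w r. w + WF_step n w r) 0 E"

end

theory Submission imports Defs "HOL-Library.Multiset" begin

text \<open>
  For nested requests WF spreads each request evenly, so for \<open>card S = j\<close> a request \<open>(N, d)\<close>
  contributes at most \<open>d * min 1 (j / card N)\<close> to the WF load of \<open>S\<close>; for \<open>E'\<close> and the last \<open>j\<close>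
  nodes this is attained. Since \<open>min 1 (j / s)\<close> decreases in \<open>s\<close>, it suffices (Abel summation) that,
  for every \<open>u\<close>, the demand of the requests of \<open>E\<close> with at most \<open>u\<close> nodes is at most that of \<open>E'\<close>. The
  former is carried by a single set of at most \<open>u\<close> nodes, the largest such set of the chain, hence
  is at most the sum of the \<open>u\<close> largest entries of any allocation, in particular of \<open>OPT n E\<close>; and that
  is the demand of the last \<open>u\<close> requests of \<open>E'\<close>.

  That \<open>OPT n E\<close> is the least element is seen by filling in reverse order, from the
  smallest set outwards, and comparing the functions \<open>k \<mapsto> (\<Sum>i. max (x i - k) 0)\<close>.
\<close>

section \<open>Majorization and hinge sums\<close>

text \<open>The total excess over the level \<open>k\<close>. By Hardy, Littlewood and Polya these
  convex sums characterize majorization, and unlike \<open>top_sum\<close> they require no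
  sorting.\<close>

definition hinge :: "nat \<Rightarrow> real \<Rightarrow> (nat \<Rightarrow> real) \<Rightarrow> real" where
  "hinge n k x = (\<Sum>i=1..n. max (x i - k) 0)"

lemma length_ascending [simp]: "length (ascending n x) = n"
  by (simp add: ascending_def)

lemma sorted_ascending [simp]: "sorted (ascending n x)"
  by (simp add: ascending_def)

lemma set_ascending: "set (ascending n x) = x ` {1..n}"
  by (auto simp: ascending_def simp del: upt_Suc)

lemma sum_list_ascending:
  fixes g :: "real \<Rightarrow> real"
  shows "sum_list (map g (ascending n x)) = (\<Sum>i=1..n. g (x i))"
proof -
  have "mset (map g (ascending n x)) = mset (map (\<lambda>i. g (x i)) [1..<Suc n])"
    by (simp add: ascending_def multiset.map_comp comp_def del: upt_Suc)
  then have "sum_list (map g (ascending n x)) = sum_list (map (\<lambda>i. g (x i)) [1..<Suc n])"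
    by (metis sum_mset_sum_list)
  also have "\<dots> = (\<Sum>i=1..n. g (x i))"
    by (simp add: interv_sum_list_conv_sum_set_nat atLeastLessThanSuc_atLeastAtMost del: upt_Suc)
  finally show ?thesis .
qed

lemma top_sum_drop: "top_sum n j x = sum_list (drop (n - j) (ascending n x))"
  by (simp add: top_sum_def take_rev)

text \<open>Each of the \<open>j\<close> entries \<open>l\<close> satisfies
  \<open>l \<le> k + max (l - k) 0\<close>, and the excesses of the other entries are
  nonnegative.\<close>

lemma top_sum_le_hinge:
  assumes "j \<le> n"
  shows "top_sum n j x \<le> real j * k + hinge n k x"
proof -
  let ?a = "ascending n x"
  have "sum_list (drop (n - j) ?a) \<le> (\<Sum>l\<leftarrow>drop (n - j) ?a. k + max (l - k) 0)"
    using sum_list_mono[of "drop (n - j) ?a" "\<lambda>l. l" "\<lambda>l. k + max (l - k) 0"] by simp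
  also have "\<dots> = real j * k + (\<Sum>l\<leftarrow>drop (n - j) ?a. max (l - k) 0)"
    using assms by (simp add: sum_list_addf sum_list_triv)
  also have "(\<Sum>l\<leftarrow>drop (n - j) ?a. max (l - k) 0) \<le>
      (\<Sum>l\<leftarrow>take (n - j) ?a. max (l - k) 0) + (\<Sum>l\<leftarrow>drop (n - j) ?a. max (l - k) 0)"
    by (auto intro!: sum_list_nonneg)
  also have "\<dots> = (\<Sum>l\<leftarrow>?a. max (l - k) 0)"
    by (metis append_take_drop_id map_append sum_list_append)
  also have "\<dots> = hinge n k x"
    unfolding hinge_def by (rule sum_list_ascending)
  finally show ?thesis by (simp add: top_sum_drop)
qed

text \<open>The \<open>j\<close>-th largest entry is a level at which the preceding bound is tight:
  smaller entries have no excess, the \<open>j\<close> largest have excess exactly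
  \<open>l - k\<close>. That the level is an entry later yields its nonnegativity.\<close>

lemma top_sum_eq_hinge:
  assumes "1 \<le> j" "j \<le> n"
  shows "\<exists>k\<in>x ` {1..n}. top_sum n j x = real j * k + hinge n k x"
proof
  let ?a = "ascending n x"
  define k where "k = ?a ! (n - j)"
  have less: "n - j < n" using assms by simp
  show "k \<in> x ` {1..n}"
    unfolding k_def using nth_mem[of "n - j" ?a] less by (simp add: set_ascending)
  have 1: "(\<Sum>l\<leftarrow>take (n - j) ?a. max (l - k) 0) = 0"
  proof -
    have "l \<le> k" if "l \<in> set (take (n - j) ?a)" for l
      using that less unfolding k_def
      by (auto simp: in_set_conv_nth intro!: sorted_nth_mono)
    then have "map (\<lambda>l. max (l - k) 0) (take (n - j) ?a) = map (\<lambda>_. 0) (take (n - j) ?a)"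
      by (intro map_cong) auto
    then show ?thesis by (simp only: sum_list_0)
  qed
  have 2: "(\<Sum>l\<leftarrow>drop (n - j) ?a. max (l - k) 0) = (\<Sum>l\<leftarrow>drop (n - j) ?a. l - k)"
  proof -
    have "k \<le> l" if "l \<in> set (drop (n - j) ?a)" for l
      using that less unfolding k_def
      by (auto simp: in_set_conv_nth intro!: sorted_nth_mono)
    then have "map (\<lambda>l. max (l - k) 0) (drop (n - j) ?a) = map (\<lambda>l. l - k) (drop (n - j) ?a)"
      by (intro map_cong) auto
    then show ?thesis by (simp only:)
  qed
  have "hinge n k x = (\<Sum>l\<leftarrow>?a. max (l - k) 0)"
    unfolding hinge_def by (rule sum_list_ascending[symmetric])
  also have "\<dots> = (\<Sum>l\<leftarrow>take (n - j) ?a. max (l - k) 0) + (\<Sum>l\<leftarrow>drop (n - j) ?a. max (l - k) 0)"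
    by (metis append_take_drop_id map_append sum_list_append)
  also have "\<dots> = sum_list (drop (n - j) ?a) - real j * k"
    using assms by (simp add: 1 2 sum_list_subtractf sum_list_triv)
  finally show "top_sum n j x = real j * k + hinge n k x"
    by (simp add: top_sum_drop)
qed

lemma sum_le_hinge:
  assumes "S \<subseteq> {1..n}"
  shows "sum x S \<le> real (card S) * k + hinge n k x"
proof -
  have "sum x S \<le> (\<Sum>i\<in>S. k + max (x i - k) 0)"
    by (intro sum_mono) simp
  also have "\<dots> = real (card S) * k + (\<Sum>i\<in>S. max (x i - k) 0)"
    by (simp add: sum.distrib)
  also have "(\<Sum>i\<in>S. max (x i - k) 0) \<le> hinge n k x"
    unfolding hinge_def using assms by (intro sum_mono2) auto
  finally show ?thesis by simp
qed

text \<open>At the tight level \<open>k\<close> for \<open>j\<close>, \<open>sum_le_hinge\<close>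
  gives the bound with \<open>card S\<close> in place of \<open>j\<close>. Since \<open>k\<close> is
  an entry it is nonnegative, so fewer than \<open>j\<close> nodes are allowed.\<close>

lemma sum_le_top_sum:
  assumes "S \<subseteq> {1..n}" "card S \<le> j" "j \<le> n" "\<And>i. 0 \<le> x i"
  shows "sum x S \<le> top_sum n j x"
proof (cases "j = 0")
  case True
  then have "S = {}" using assms finite_subset[OF assms(1)] by simp
  then show ?thesis by (simp add: True top_sum_def)
next
  case False
  then obtain k where "k \<in> x ` {1..n}" and k: "top_sum n j x = real j * k + hinge n k x"
    using top_sum_eq_hinge[of j n x] assms(3) by auto
  then have "0 \<le> k" using assms(4) by auto
  then have "real (card S) * k \<le> real j * k" using assms(2) by (simp add: mult_right_mono)
  then show ?thesis using sum_le_hinge[OF assms(1), of x k] k by simp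
qed

text \<open>The nodes with load above \<open>k\<close> make \<open>sum_le_hinge\<close>
  tight.\<close>

lemma hinge_attained: "\<exists>S\<subseteq>{1..n}. hinge n k x = sum x S - real (card S) * k"
proof (intro exI conjI)
  let ?S = "{i\<in>{1..n}. k < x i}"
  show "?S \<subseteq> {1..n}" by auto
  have "hinge n k x = (\<Sum>i\<in>?S. max (x i - k) 0)"
    unfolding hinge_def by (rule sum.mono_neutral_right) auto
  also have "\<dots> = (\<Sum>i\<in>?S. x i - k)"
    by (intro sum.cong) auto
  finally show "hinge n k x = sum x ?S - real (card ?S) * k"
    by (simp add: sum_subtractf)
qed

text \<open>Top sums and hinge sums are dual: \<open>top_sum n j x\<close> is the minimum over
  \<open>k\<close> of \<open>j * k + hinge n k x\<close>, and \<open>hinge n k x\<close> is the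
  maximum over \<open>j\<close> of \<open>top_sum n j x - j * k\<close>. Hence either family of
  inequalities implies the other.\<close>

lemma majorizes_iff_hinge:
  "majorizes n x y \<longleftrightarrow>
     (\<forall>i\<in>{1..n}. 0 \<le> x i \<and> 0 \<le> y i) \<and> (\<Sum>i=1..n. x i) = (\<Sum>i=1..n. y i)
     \<and> (\<forall>k. hinge n k y \<le> hinge n k x)"
proof -
  have "hinge n k y \<le> hinge n k x"
    if nn: "\<forall>i\<in>{1..n}. 0 \<le> y i" and top: "\<forall>j\<in>{1..n}. top_sum n j y \<le> top_sum n j x" for k
  proof -
    obtain S where S: "S \<subseteq> {1..n}" "hinge n k y = sum y S - real (card S) * k"
      using hinge_attained by blast
    have card: "card S \<le> n" using card_mono[OF _ S(1)] by simp
    \<comment> \<open>\<open>sum_le_top_sum\<close> asks for nonnegativity at every index, while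
      here it is known only on \<open>{1..n}\<close>; truncation changes no top sum.\<close>
    define y' where "y' i = (if i \<in> {1..n} then y i else 0)" for i
    have "sum y S = sum y' S" using S(1) by (intro sum.cong) (auto simp: y'_def)
    also have "\<dots> \<le> top_sum n (card S) y'"
      using S(1) card nn by (intro sum_le_top_sum) (auto simp: y'_def)
    also have "top_sum n (card S) y' = top_sum n (card S) y"
    proof -
      have "map y' [1..<Suc n] = map y [1..<Suc n]"
        by (intro map_cong) (auto simp: y'_def)
      then show ?thesis by (simp only: top_sum_def ascending_def)
    qed
    also have "\<dots> \<le> top_sum n (card S) x"
    proof (cases "card S = 0")
      case False
      then show ?thesis using top card by auto
    qed (simp add: top_sum_def)
    also have "\<dots> \<le> real (card S) * k + hinge n k x"
      by (rule top_sum_le_hinge[OF card])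
    finally show ?thesis using S(2) by simp
  qed
  moreover have "top_sum n j y \<le> top_sum n j x"
    if h: "\<forall>k. hinge n k y \<le> hinge n k x" and j: "j \<in> {1..n}" for j
  proof -
    obtain k where "top_sum n j x = real j * k + hinge n k x"
      using top_sum_eq_hinge[of j n x] j by auto
    then show ?thesis using top_sum_le_hinge[of j n y k] h j by (simp add: order_trans)
  qed
  ultimately show ?thesis unfolding majorizes_def by blast
qed

section \<open>Allocations and OPT\<close>

lemma Delta_seq_Nil [simp]: "Delta_seq n [] = {0}"
  by (simp add: Delta_seq_def)

lemma mem_Delta_seq_Cons:
  "x \<in> Delta_seq n ((N, d) # E) \<longleftrightarrow> (\<exists>a\<in>Delta n N d. \<exists>b\<in>Delta_seq n E. x = a + b)"
  by (auto simp: Delta_seq_def set_plus_def)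

lemma Delta_seq_nonneg: "x \<in> Delta_seq n E \<Longrightarrow> 0 \<le> x i"
proof (induction E arbitrary: x)
  case (Cons r E)
  obtain N d where "r = (N, d)" by force
  then show ?case using Cons by (force simp: mem_Delta_seq_Cons Delta_def)
qed simp

text \<open>The set \<open>A\<close> is kept general: it will be \<open>{1..n}\<close>, or the
  outermost set of a nested sequence.\<close>

lemma Delta_seq_support:
  "x \<in> Delta_seq n E \<Longrightarrow> \<forall>(N, d)\<in>set E. N \<subseteq> A \<Longrightarrow> i \<notin> A \<Longrightarrow> x i = 0"
proof (induction E arbitrary: x)
  case (Cons r E)
  obtain N d where "r = (N, d)" by force
  then obtain a b where "x = a + b" "a \<in> Delta n N d" "b \<in> Delta_seq n E" "N \<subseteq> A"
    using Cons.prems by (auto simp: mem_Delta_seq_Cons)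
  moreover from this have "b i = 0" using Cons by auto
  ultimately show ?case using Cons.prems by (auto simp: Delta_def)
qed simp

lemma Delta_seq_sum: "x \<in> Delta_seq n E \<Longrightarrow> (\<Sum>i=1..n. x i) = (\<Sum>(N, d)\<leftarrow>E. d)"
proof (induction E arbitrary: x)
  case (Cons r E)
  obtain N d where "r = (N, d)" by force
  then show ?case using Cons by (auto simp: mem_Delta_seq_Cons Delta_def sum.distrib)
qed simp

lemma Delta_seq_midpoint:
  "x \<in> Delta_seq n E \<Longrightarrow> y \<in> Delta_seq n E \<Longrightarrow> (\<lambda>i. (x i + y i) / 2) \<in> Delta_seq n E"
proof (induction E arbitrary: x y)
  case (Cons r E)
  obtain N d where r: "r = (N, d)" by force
  then obtain a b a' b' where ab: "x = a + b" "a \<in> Delta n N d" "b \<in> Delta_seq n E"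
    "y = a' + b'" "a' \<in> Delta n N d" "b' \<in> Delta_seq n E"
    using Cons.prems by (auto simp: mem_Delta_seq_Cons)
  have "(\<lambda>i. (a i + a' i) / 2) \<in> Delta n N d"
    using ab by (auto simp: Delta_def sum.distrib simp flip: sum_divide_distrib)
  moreover have "(\<lambda>i. (b i + b' i) / 2) \<in> Delta_seq n E" using Cons.IH ab by blast
  moreover have "(\<lambda>i. (x i + y i) / 2) = (\<lambda>i. (a i + a' i) / 2) + (\<lambda>i. (b i + b' i) / 2)"
    using ab by (auto simp: fun_eq_iff add_divide_distrib)
  ultimately show ?case unfolding r mem_Delta_seq_Cons by blast
qed (simp add: fun_eq_iff)

lemma Delta_seq_map:
  assumes "\<And>t. t \<in> set ts \<Longrightarrow> f t \<in> Delta n (N t) (d t)"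
  shows "(\<lambda>i. \<Sum>t\<leftarrow>ts. f t i) \<in> Delta_seq n (map (\<lambda>t. (N t, d t)) ts)"
  using assms
proof (induction ts)
  case (Cons t ts)
  then have "f t \<in> Delta n (N t) (d t)"
    "(\<lambda>i. \<Sum>t\<leftarrow>ts. f t i) \<in> Delta_seq n (map (\<lambda>t. (N t, d t)) ts)" by auto
  moreover have "(\<lambda>i. \<Sum>t\<leftarrow>t # ts. f t i) = f t + (\<lambda>i. \<Sum>t\<leftarrow>ts. f t i)" by (simp add: fun_eq_iff)
  ultimately show ?case by (auto simp: mem_Delta_seq_Cons)
qed (simp add: fun_eq_iff)

text \<open>
  If \<open>x\<close> and \<open>y\<close> are both least, then so is their midpoint \<open>w\<close>, and equality of all hinge
  sums at \<open>k = w i\<close> forces \<open>x i = y i\<close>.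
\<close>

lemma OPT_eq:
  assumes E: "E \<in> requests n m q"
    and x: "x \<in> Delta_seq n E" and least: "\<And>y. y \<in> Delta_seq n E \<Longrightarrow> majorizes n y x"
  shows "OPT n E = x"
  unfolding OPT_def
proof (rule the_equality)
  show "maj_minimal n (Delta_seq n E) x"
    using x least by (auto simp: maj_minimal_def)
next
  fix y assume "maj_minimal n (Delta_seq n E) y"
  then have y: "y \<in> Delta_seq n E" and yx: "majorizes n x y"
    using least x by (auto simp: maj_minimal_def)
  define w where "w i = (x i + y i) / 2" for i
  have "w \<in> Delta_seq n E"
    unfolding w_def by (rule Delta_seq_midpoint[OF x y])
  note wx = least[OF this]
  have "y i = x i" for i
  proof (cases "i \<in> {1..n}")
    case False
    have "\<forall>(N, d)\<in>set E. N \<subseteq> {1..n}" using E by (auto simp: requests_def)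
    then show ?thesis using Delta_seq_support x y False by metis
  next
    case True
    \<comment> \<open>The convexity gap of the hinge function at node \<open>j\<close> for the level
      \<open>w i\<close>. It is nonnegative at every \<open>j\<close>, and if it vanishes at
      \<open>j = i\<close>, neither \<open>x i\<close> nor \<open>y i\<close> exceeds their
      mean.\<close>
    define g where "g j = (max (x j - w i) 0 + max (y j - w i) 0) / 2 - max (w j - w i) 0" for j
    have g: "0 \<le> g j" for j
      by (auto simp: g_def w_def max_def field_simps)
    have "(\<Sum>j=1..n. g j) = (hinge n (w i) x + hinge n (w i) y) / 2 - hinge n (w i) w"
      by (simp add: g_def hinge_def sum_subtractf sum.distrib flip: sum_divide_distrib)
    also have "\<dots> \<le> 0"
    proof -
      have "hinge n (w i) y \<le> hinge n (w i) x" "hinge n (w i) x \<le> hinge n (w i) w"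
        using wx yx by (auto simp: majorizes_iff_hinge)
      then show ?thesis by (simp add: field_simps)
    qed
    finally have "(\<Sum>j=1..n. g j) = 0" using g by (simp add: sum_nonneg antisym)
    then have "g i = 0" using True g by (simp add: sum_nonneg_eq_0_iff)
    then show ?thesis by (auto simp: g_def w_def max_def field_simps split: if_splits)
  qed
  then show "y = x" by (rule ext)
qed

section \<open>Reverse filling yields a least allocation of a nested sequence\<close>

lemma fill_level_exists:
  fixes x :: "nat \<Rightarrow> real"
  assumes "finite N" "N \<noteq> {}" "\<And>i. 0 \<le> x i" "0 \<le> d"
  shows "\<exists>l\<ge>0. (\<Sum>i\<in>N. max (x i) l) = sum x N + d"
proof -
  \<comment> \<open>Intermediate value theorem: level \<open>0\<close> needs at most the target
    total \<open>?b\<close>, whereas level \<open>?b\<close> already puts \<open>?b\<close> on a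
    single node.\<close>
  define f where "f l = (\<Sum>i\<in>N. max (x i) l)" for l
  let ?b = "sum x N + d"
  have b: "0 \<le> ?b" using assms by (simp add: sum_nonneg)
  obtain i where i: "i \<in> N" using assms(2) by blast
  have "?b \<le> max (x i) ?b" by simp
  also have "\<dots> \<le> f ?b"
    unfolding f_def using assms i b
    by (intro member_le_sum) (auto simp: le_max_iff_disj)
  finally have "?b \<le> f ?b" .
  moreover have "f 0 \<le> ?b" using assms(3,4) by (simp add: f_def max_absorb1)
  moreover have "continuous_on {0..?b} f"
    unfolding f_def by (intro continuous_intros)
  ultimately obtain l where "0 \<le> l" "l \<le> ?b" "f l = ?b"
    using IVT'[of f 0 ?b ?b] b by blast
  then show ?thesis unfolding f_def by blast
qed

text \<open>The part outside \<open>N\<close> is the same for all vectors supported on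
  \<open>N\<close>, so comparing their hinge sums reduces to \<open>N\<close>. It does not vanish in
  general, since \<open>k\<close> may be negative.\<close>

lemma hinge_eq_sum_support:
  assumes "N \<subseteq> {1..n}" "\<And>i. i \<notin> N \<Longrightarrow> x i = 0"
  shows "hinge n k x = (\<Sum>i\<in>N. max (x i - k) 0) + (\<Sum>i\<in>{1..n} - N. max (- k) 0)"
proof -
  have "hinge n k x = (\<Sum>i\<in>N. max (x i - k) 0) + (\<Sum>i\<in>{1..n} - N. max (x i - k) 0)"
    unfolding hinge_def using assms(1) by (simp add: sum.subset_diff add.commute)
  also have "(\<Sum>i\<in>{1..n} - N. max (x i - k) 0) = (\<Sum>i\<in>{1..n} - N. max (- k) 0)"
    using assms(2) by (intro sum.cong) auto
  finally show ?thesis .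
qed

lemma nested_requests_ConsD:
  assumes "(N, d) # E \<in> nested_requests n m q"
  shows "E \<in> nested_requests n (m - 1) (q - d)" "N \<subseteq> {1..n}" "0 \<le> d" "N = {} \<Longrightarrow> d = 0"
    "\<forall>(N', d')\<in>set E. N' \<subseteq> N"
  using assms by (auto simp: nested_requests_def requests_def split_beta)

text \<open>Induction on the list treats the tail, hence the smaller sets, first. The head request
  may use every node of the tail, so its demand can be poured onto the least loads of a least tail
  allocation up to a common level.\<close>

lemma least_allocation_exists:
  "E \<in> nested_requests n m q \<Longrightarrow>
    \<exists>x\<in>Delta_seq n E. \<forall>y\<in>Delta_seq n E. majorizes n y x"
proof (induction E arbitrary: m q)
  case Nil
  then show ?case by (simp add: majorizes_def)
next
  case (Cons r E)
  obtain N d where r: "r = (N, d)" by force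
  note nest = nested_requests_ConsD[OF Cons.prems[unfolded r]]
  obtain x where x: "x \<in> Delta_seq n E" and least: "\<And>y. y \<in> Delta_seq n E \<Longrightarrow> majorizes n y x"
    using Cons.IH[OF nest(1)] by blast
  have fin: "finite N" using nest(2) finite_subset by blast
  have supp: "y i = 0" if "y \<in> Delta_seq n E" "i \<notin> N" for y i
    using Delta_seq_support[OF that(1) nest(5) that(2)] .
  show ?case
  proof (cases "N = {}")
    case True
    then have "Delta n N d = {0}" using nest(4) by (auto simp: Delta_def fun_eq_iff)
    then have "Delta_seq n (r # E) = Delta_seq n E"
      unfolding r by (auto simp: mem_Delta_seq_Cons)
    then show ?thesis using x least by blast
  next
    case False
    obtain l where l: "0 \<le> l" "(\<Sum>i\<in>N. max (x i) l) = sum x N + d"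
      using fill_level_exists[OF fin False, of x d] Delta_seq_nonneg[OF x] nest(3) by blast
    define z where "z i = (if i \<in> N then max (x i) l else 0)" for i
    have sum_z: "sum z N = sum x N + d" using l(2) by (simp add: z_def)
    have sumN: "(\<Sum>i=1..n. v i) = sum v N" if "\<And>i. i \<notin> N \<Longrightarrow> v i = 0" for v :: "nat \<Rightarrow> real"
      using that nest(2) by (intro sum.mono_neutral_right) auto
    have supp_z: "i \<notin> N \<Longrightarrow> z i = 0" for i by (simp add: z_def)
    have "(\<lambda>i. z i - x i) \<in> Delta n N d"
    proof -
      have "(\<Sum>i=1..n. z i - x i) = sum z N - sum x N"
        using sumN[of "\<lambda>i. z i - x i"] supp[OF x] supp_z by (simp add: sum_subtractf)
      then show ?thesis using sum_z supp[OF x] by (auto simp: Delta_def z_def)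
    qed
    moreover have "z = (\<lambda>i. z i - x i) + x" by (simp add: fun_eq_iff)
    ultimately have z: "z \<in> Delta_seq n (r # E)"
      unfolding r mem_Delta_seq_Cons using x by blast
    have "majorizes n y z" if y: "y \<in> Delta_seq n (r # E)" for y
      unfolding majorizes_iff_hinge
    proof (intro conjI ballI allI)
      show "0 \<le> y i" "0 \<le> z i" for i using Delta_seq_nonneg y z by blast+
      show sums: "(\<Sum>i=1..n. y i) = (\<Sum>i=1..n. z i)"
        using Delta_seq_sum y z by metis
      fix k
      obtain a b where ab: "y = a + b" "a \<in> Delta n N d" "b \<in> Delta_seq n E"
        using y unfolding r mem_Delta_seq_Cons by blast
      have supp_y: "i \<notin> N \<Longrightarrow> y i = 0" for i
        using ab supp by (auto simp: Delta_def)
      have N_le: "(\<Sum>i\<in>N. max (z i - k) 0) \<le> (\<Sum>i\<in>N. max (y i - k) 0)"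
      \<comment> \<open>If \<open>l \<le> k\<close>, pouring creates no excess over
        \<open>k\<close>, so the excess is that of \<open>x\<close>, which is least for the tail,
        and \<open>y\<close> dominates its tail part \<open>b\<close>. Otherwise all of
        \<open>z\<close> on \<open>N\<close> lies above \<open>k\<close>, and its excess is the
        total minus \<open>card N * k\<close>, a lower bound for every \<open>y\<close>.\<close>
      proof (cases "l \<le> k")
        case True
        have "(\<Sum>i\<in>N. max (z i - k) 0) = (\<Sum>i\<in>N. max (x i - k) 0)"
          using True by (intro sum.cong) (auto simp: z_def max_def)
        also have "\<dots> \<le> (\<Sum>i\<in>N. max (b i - k) 0)"
        proof -
          have "hinge n k x \<le> hinge n k b"
            using least[OF ab(3)] by (simp add: majorizes_iff_hinge)
          then show ?thesis
            using hinge_eq_sum_support[OF nest(2), of x k] hinge_eq_sum_support[OF nest(2), of b k]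
              supp[OF x] supp[OF ab(3)] by simp
        qed
        also have "\<dots> \<le> (\<Sum>i\<in>N. max (y i - k) 0)"
        proof (intro sum_mono)
          fix i
          have "0 \<le> a i" using ab(2) by (simp add: Delta_def)
          then show "max (b i - k) 0 \<le> max (y i - k) 0" by (simp add: ab(1) max_def)
        qed
        finally show ?thesis .
      next
        case False
        have "(\<Sum>i\<in>N. max (z i - k) 0) = (\<Sum>i\<in>N. z i - k)"
          using False by (intro sum.cong) (auto simp: z_def max_def)
        also have "\<dots> = (\<Sum>i\<in>N. y i - k)"
          using sums sumN[of z] sumN[of y] supp_z supp_y by (simp add: sum_subtractf)
        also have "\<dots> \<le> (\<Sum>i\<in>N. max (y i - k) 0)"
          by (intro sum_mono) simp
        finally show ?thesis .
      qed
      then show "hinge n k z \<le> hinge n k y"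
        using hinge_eq_sum_support[OF nest(2), of z k] hinge_eq_sum_support[OF nest(2), of y k]
          supp_z supp_y by simp
    qed
    then show ?thesis using z by blast
  qed
qed

lemma OPT_in_Delta_seq:
  assumes "E \<in> nested_requests n m q"
  shows "OPT n E \<in> Delta_seq n E"
proof -
  have "E \<in> requests n m q" using assms by (simp add: nested_requests_def)
  then show ?thesis using least_allocation_exists[OF assms] OPT_eq by metis
qed

section \<open>Demand of the small requests\<close>

definition small_demand :: "request list \<Rightarrow> nat \<Rightarrow> real" where
  "small_demand E u = (\<Sum>(N, d)\<leftarrow>E. if card N \<le> u then d else 0)"

text \<open>\<open>T\<close> is the first set of the chain with at most \<open>u\<close> nodes: by
  nestedness it carries all the load from there on. Earlier requests do not count and only add
  nonnegative load.\<close>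

lemma small_demand_le_sum:
  assumes "E \<in> nested_requests n m q" "x \<in> Delta_seq n E"
  shows "\<exists>T\<subseteq>{1..n}. card T \<le> u \<and> small_demand E u \<le> sum x T"
  using assms
proof (induction E arbitrary: m q x)
  case Nil
  then show ?case by (intro exI[of _ "{}"]) (simp add: small_demand_def)
next
  case (Cons r E)
  obtain N d where r: "r = (N, d)" by force
  note nest = nested_requests_ConsD[OF Cons.prems(1)[unfolded r]]
  obtain a b where ab: "x = a + b" "a \<in> Delta n N d" "b \<in> Delta_seq n E"
    using Cons.prems(2) unfolding r mem_Delta_seq_Cons by blast
  show ?case
  proof (cases "card N \<le> u")
    case True
    have "small_demand (r # E) u \<le> (\<Sum>(N, d)\<leftarrow>r # E. d)"
      unfolding small_demand_def
    proof (intro sum_list_mono, clarify)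
      fix N' d' assume "(N', d') \<in> set (r # E)"
      moreover have "\<forall>(N, d)\<in>set (r # E). N \<subseteq> {1..n} \<and> 0 \<le> d \<and> (N = {} \<longrightarrow> d = 0)"
        using Cons.prems(1) unfolding nested_requests_def requests_def by blast
      ultimately have "0 \<le> d'" by blast
      then show "(if card N' \<le> u then d' else 0) \<le> d'" by simp
    qed
    also have "\<dots> = (\<Sum>i=1..n. x i)" using Delta_seq_sum[OF Cons.prems(2)] by simp
    also have "\<dots> = sum x N"
      using nest(2) Delta_seq_support[OF Cons.prems(2), of N] nest(5) r
      by (intro sum.mono_neutral_right) auto
    finally show ?thesis using True nest(2) by blast
  next
    case False
    obtain T where T: "T \<subseteq> {1..n}" "card T \<le> u" "small_demand E u \<le> sum b T"
      using Cons.IH[OF nest(1) ab(3)] by blast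
    have "small_demand (r # E) u = small_demand E u" using False by (simp add: small_demand_def r)
    also have "\<dots> \<le> sum b T" by (rule T)
    also have "\<dots> \<le> sum x T" using ab by (intro sum_mono) (simp add: Delta_def)
    finally show ?thesis using T by blast
  qed
qed

lemma small_demand_le_top_sum:
  assumes "E \<in> nested_requests n m q" "x \<in> Delta_seq n E" "u \<le> n"
  shows "small_demand E u \<le> top_sum n u x"
  using small_demand_le_sum[OF assms(1,2), of u] sum_le_top_sum[of _ n u x]
    Delta_seq_nonneg[OF assms(2)] assms(3) by (meson order_trans)

text \<open>Abel summation: \<open>w (card N) - w n\<close> telescopes over
  \<open>card N \<le> u < n\<close>, and collecting the demands for fixed \<open>u\<close> gives
  \<open>small_demand E u\<close>.\<close>

lemma weighted_demand:
  fixes w :: "nat \<Rightarrow> real"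
  assumes "\<forall>(N, d)\<in>set E. card N \<le> n"
  shows "(\<Sum>(N, d)\<leftarrow>E. d * w (card N)) =
    w n * (\<Sum>(N, d)\<leftarrow>E. d) + (\<Sum>u<n. (w u - w (Suc u)) * small_demand E u)"
  using assms
proof (induction E)
  case (Cons r E)
  obtain N d where r: "r = (N, d)" by force
  have le: "card N \<le> n" using Cons.prems r by simp
  have "(\<Sum>u<n. (w u - w (Suc u)) * (if card N \<le> u then d else 0)) =
      (\<Sum>u\<in>{card N..<n}. (w u - w (Suc u)) * d)"
    by (intro sum.mono_neutral_cong_right) auto
  also have "\<dots> = (w (card N) - w n) * d"
    using sum_Suc_diff'[OF le, of "\<lambda>u. - w u"] by (simp flip: sum_distrib_right)
  finally have "(\<Sum>u<n. (w u - w (Suc u)) * (if card N \<le> u then d else 0)) = (w (card N) - w n) * d" .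
  moreover have "small_demand (r # E) u = (if card N \<le> u then d else 0) + small_demand E u" for u
    by (simp add: small_demand_def r)
  ultimately show ?case using Cons r by (simp add: algebra_simps sum.distrib sum_subtractf)
qed (simp add: small_demand_def)

section \<open>Water-filling on nested requests\<close>

definition even_share :: "request \<Rightarrow> nat \<Rightarrow> real" where
  "even_share = (\<lambda>(N, d) i. if i \<in> N then d / real (card N) else 0)"

text \<open>On equal loads \<open>c\<close>, the minimum is at most \<open>c\<close> plus the
  average \<open>d / card N\<close>, with equality only if \<open>x\<close> is constant on
  \<open>N\<close>.\<close>

lemma WF_step_uniform:
  assumes N: "N \<subseteq> {1..n}" and d: "0 \<le> d" "N = {} \<Longrightarrow> d = 0"
    and w: "\<And>i. i \<in> N \<Longrightarrow> w i = c"
  shows "WF_step n w (N, d) = even_share (N, d)"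
proof (cases "N = {}")
  case True
  \<comment> \<open>The feasible set is a singleton, so the unspecified minimum over the empty set
    does not matter.\<close>
  then have "x \<in> Delta n N d \<longleftrightarrow> x = even_share (N, d)" for x
    using d by (auto simp: Delta_def even_share_def fun_eq_iff)
  then have "is_arg_max f (\<lambda>x. x \<in> Delta n N d) x \<longleftrightarrow> x = even_share (N, d)"
    for f :: "(nat \<Rightarrow> real) \<Rightarrow> real" and x
    by (auto simp: is_arg_max_def)
  then show ?thesis unfolding WF_step_def prod.case by (intro the_equality) simp_all
next
  case False
  have fin: "finite N" using N finite_subset by blast
  have card: "0 < card N" using fin False by (simp add: card_gt_0_iff)
  let ?e = "even_share (N, d)" and ?f = "\<lambda>x. MIN i\<in>N. x i + w i"
  have sumN: "(\<Sum>i=1..n. v i) = sum v N" if "\<And>i. i \<notin> N \<Longrightarrow> v i = 0" for v :: "nat \<Rightarrow> real"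
    using that N by (intro sum.mono_neutral_right) auto
  have e: "?e \<in> Delta n N d"
    using sumN[of ?e] card d by (auto simp: Delta_def even_share_def)
  have fe: "?f ?e = d / card N + c"
  proof -
    have "(\<lambda>i. ?e i + w i) ` N = {d / card N + c}"
      using False w by (auto simp: even_share_def)
    then show ?thesis by simp
  qed
  \<comment> \<open>An allocation at least as good as the even one has all entries on
    \<open>N\<close> at least the average, hence equal to it. This gives optimality and uniqueness
    at once.\<close>
  have eqI: "x = ?e" if x: "x \<in> Delta n N d" and f: "?f ?e \<le> ?f x" for x
  proof -
    have ge: "d / card N \<le> x i" if "i \<in> N" for i
    proof -
      have "?f x \<le> x i + w i" using fin that by (intro Min_le) auto
      then show ?thesis using f fe w[OF that] by simp
    qed
    have "(\<Sum>i\<in>N. x i - d / card N) = 0"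
      using x sumN[of x] card by (auto simp: Delta_def sum_subtractf)
    then have "\<forall>i\<in>N. x i - d / card N = 0"
      using ge fin by (subst (asm) sum_nonneg_eq_0_iff) auto
    then show ?thesis using x by (auto simp: Delta_def even_share_def fun_eq_iff)
  qed
  show ?thesis unfolding WF_step_def prod.case
  proof (rule the_equality)
    show "is_arg_max ?f (\<lambda>x. x \<in> Delta n N d) ?e"
      unfolding is_arg_max_def
    proof (intro conjI notI)
      assume "\<exists>y. y \<in> Delta n N d \<and> ?f ?e < ?f y"
      then obtain y where y: "y \<in> Delta n N d" "?f ?e < ?f y" by blast
      then have "y = ?e" by (intro eqI) auto
      then show False using y(2) by simp
    qed (rule e)
  next
    fix x assume x: "is_arg_max ?f (\<lambda>x. x \<in> Delta n N d) x"
    then have "x \<in> Delta n N d" "\<not> ?f x < ?f ?e"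
      using e unfolding is_arg_max_def by blast+
    then show "x = ?e" by (intro eqI) (simp_all only: not_less)
  qed
qed

text \<open>The invariant is that the load is constant on every remaining set. An even share on
  \<open>N\<close> preserves it because all later sets lie inside \<open>N\<close>.\<close>

lemma foldl_WF_step:
  assumes "E \<in> nested_requests n m q" "\<forall>(N, d)\<in>set E. \<exists>c. \<forall>i\<in>N. w i = c"
  shows "foldl (\<lambda>w r. w + WF_step n w r) w E = w + (\<lambda>i. \<Sum>r\<leftarrow>E. even_share r i)"
  using assms
proof (induction E arbitrary: m q w)
  case Nil
  then show ?case by (simp add: fun_eq_iff)
next
  case (Cons r E)
  obtain N d where r: "r = (N, d)" by force
  note nest = nested_requests_ConsD[OF Cons.prems(1)[unfolded r]]
  obtain c where c: "\<And>i. i \<in> N \<Longrightarrow> w i = c" using Cons.prems(2) r by auto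
  have step: "WF_step n w r = even_share r"
    unfolding r using nest(2-4) c by (rule WF_step_uniform)
  have "\<exists>c. \<forall>i\<in>N'. (w + even_share r) i = c" if "(N', d') \<in> set E" for N' d'
  proof -
    have "N' \<subseteq> N" using nest(5) that by auto
    then show ?thesis using c by (intro exI[of _ "c + d / card N"]) (auto simp: r even_share_def)
  qed
  then have "foldl (\<lambda>w r. w + WF_step n w r) (w + even_share r) E =
      w + even_share r + (\<lambda>i. \<Sum>r\<leftarrow>E. even_share r i)"
    using Cons.IH[OF nest(1)] by blast
  then have "foldl (\<lambda>w r. w + WF_step n w r) w (r # E) =
      w + even_share r + (\<lambda>i. \<Sum>r\<leftarrow>E. even_share r i)"
    by (simp only: foldl.simps step)
  also have "\<dots> = w + (\<lambda>i. \<Sum>r\<leftarrow>r # E. even_share r i)"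
    by (simp add: fun_eq_iff add.assoc)
  finally show ?case .
qed

lemma WF_nested:
  assumes "E \<in> nested_requests n m q"
  shows "WF n E i = (\<Sum>r\<leftarrow>E. even_share r i)"
  using foldl_WF_step[OF assms, of 0] by (auto simp: WF_def)

text \<open>An even share gives \<open>S\<close> the fraction of \<open>N\<close> lying in
  \<open>S\<close>; for empty \<open>N\<close> the quotient is \<open>0 / 0 = 0\<close>, matching
  the zero share.\<close>

lemma sum_WF_nested:
  assumes "E \<in> nested_requests n m q" "finite S"
  shows "sum (WF n E) S = (\<Sum>(N, d)\<leftarrow>E. d * (real (card (S \<inter> N)) / real (card N)))"
proof -
  have "sum (WF n E) S = (\<Sum>i\<in>S. \<Sum>r\<leftarrow>E. even_share r i)"
    by (simp add: WF_nested[OF assms(1)])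
  also have "\<dots> = (\<Sum>r\<leftarrow>E. sum (even_share r) S)"
    by (induction E) (simp_all add: sum.distrib)
  also have "\<dots> = (\<Sum>(N, d)\<leftarrow>E. d * (real (card (S \<inter> N)) / real (card N)))"
    using assms(2) by (intro arg_cong[where f = sum_list] map_cong)
      (auto simp: even_share_def sum.If_cases Int_def)
  finally show ?thesis .
qed

lemma WF_nested_nonneg:
  assumes "E \<in> nested_requests n m q"
  shows "0 \<le> WF n E i"
  unfolding WF_nested[OF assms] using assms
  by (intro sum_list_nonneg)
    (auto simp: even_share_def nested_requests_def requests_def split: if_splits)

lemma WF_nested_total:
  assumes "E \<in> nested_requests n m q"
  shows "(\<Sum>i=1..n. WF n E i) = q"
proof -
  have "(\<Sum>i=1..n. WF n E i) = (\<Sum>(N, d)\<leftarrow>E. d * (real (card ({1..n} \<inter> N)) / real (card N)))"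
    by (rule sum_WF_nested[OF assms]) simp
  also have "\<dots> = (\<Sum>(N, d)\<leftarrow>E. d)"
  proof (intro arg_cong[where f = sum_list] map_cong refl, clarify)
    fix N d assume "(N, d) \<in> set E"
    then have "N \<subseteq> {1..n}" "N = {} \<longrightarrow> d = 0"
      using assms by (auto simp: nested_requests_def requests_def)
    moreover from this have "finite N" using finite_subset by blast
    ultimately show "d * (real (card ({1..n} \<inter> N)) / real (card N)) = d"
      by (cases "N = {}") (simp_all add: Int_absorb1)
  qed
  also have "\<dots> = q" using assms by (simp add: nested_requests_def requests_def)
  finally show ?thesis .
qed

text \<open>
  \<open>j / max j s\<close> is \<open>min 1 (j / s)\<close>, written so that it is also antitone at \<open>s = 0\<close>.
\<close>

lemma sum_WF_nested_le:
  assumes E: "E \<in> nested_requests n m q" and S: "finite S"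
  shows "sum (WF n E) S \<le> (\<Sum>(N, d)\<leftarrow>E. d * (real (card S) / real (max (card S) (card N))))"
  unfolding sum_WF_nested[OF E S]
proof (intro sum_list_mono, clarify)
  fix N d assume "(N, d) \<in> set E"
  then have N: "N \<subseteq> {1..n}" "0 \<le> d" "N = {} \<longrightarrow> d = 0"
    using E by (auto simp: nested_requests_def requests_def)
  then have "finite N" using finite_subset by blast
  then have "card (S \<inter> N) \<le> card S" "card (S \<inter> N) \<le> card N"
    using S by (auto intro: card_mono)
  then have "real (card (S \<inter> N)) / real (card N) \<le> real (card S) / real (max (card S) (card N))"
    by (cases "card N = 0") (auto simp: max_def field_simps)
  then show "d * (real (card (S \<inter> N)) / real (card N)) \<le>
      d * (real (card S) / real (max (card S) (card N)))"
    using N(2) by (rule mult_left_mono)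
qed

section \<open>Suffix requests\<close>

lemma map_nth_ascending: "map (\<lambda>t. ascending n x ! (t - 1)) [1..<Suc n] = ascending n x"
  by (rule nth_equalityI) (auto simp del: upt_Suc)

text \<open>The form of \<open>E'\<close> with its demands as a parameter, so that the comparison
  can be proved for any allocation, not only for \<open>OPT n E\<close>.\<close>

definition suffix_requests :: "nat \<Rightarrow> real list \<Rightarrow> request list" where
  "suffix_requests n a = map (\<lambda>t. ({t..n}, a ! (t - 1))) [1..<Suc n]"

lemma sum_list_suffix_requests:
  fixes g :: "nat set \<Rightarrow> real \<Rightarrow> real"
  shows "(\<Sum>(N, d)\<leftarrow>suffix_requests n a. g N d) = (\<Sum>t=1..n. g {t..n} (a ! (t - 1)))"
  by (simp add: suffix_requests_def comp_def interv_sum_list_conv_sum_set_nat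
      atLeastLessThanSuc_atLeastAtMost del: upt_Suc)

lemma ascending_nth_nonneg:
  assumes "\<And>i. i \<in> {1..n} \<Longrightarrow> 0 \<le> x i" "l < n"
  shows "0 \<le> ascending n x ! l"
proof -
  have "ascending n x ! l \<in> x ` {1..n}"
    unfolding set_ascending[symmetric] using assms(2) by (intro nth_mem) simp
  then obtain i where "i \<in> {1..n}" "ascending n x ! l = x i" by blast
  then show ?thesis using assms(1)[of i] by simp
qed

lemma suffix_requests_nested:
  assumes "\<And>i. i \<in> {1..n} \<Longrightarrow> 0 \<le> x i" "(\<Sum>i=1..n. x i) = q"
  shows "suffix_requests n (ascending n x) \<in> nested_requests n n q"
proof -
  have "0 \<le> ascending n x ! (t - 1)" if "t \<in> {1..n}" for t
    using that by (intro ascending_nth_nonneg[OF assms(1)]) auto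
  moreover have "(\<Sum>(N, d)\<leftarrow>suffix_requests n (ascending n x). d) = q"
  proof -
    have "(\<Sum>(N, d)\<leftarrow>suffix_requests n (ascending n x). d) =
        sum_list (map (\<lambda>t. ascending n x ! (t - 1)) [1..<Suc n])"
      by (simp add: suffix_requests_def comp_def del: upt_Suc)
    also have "\<dots> = q"
      unfolding map_nth_ascending using sum_list_ascending[of "\<lambda>l. l" n x] assms(2) by simp
    finally show ?thesis .
  qed
  moreover have "sorted_wrt (\<supseteq>) (map fst (suffix_requests n (ascending n x)))"
    by (simp add: suffix_requests_def comp_def sorted_wrt_iff_nth_less del: upt_Suc)
  ultimately show ?thesis
    by (auto simp: nested_requests_def requests_def suffix_requests_def simp del: upt_Suc)
qed

text \<open>\<open>{t..n}\<close> has \<open>n + 1 - t\<close> nodes, so the requests counted are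
  the last \<open>u\<close>, and their demands are the \<open>u\<close> largest entries of
  \<open>x\<close>.\<close>

lemma small_demand_suffix_requests:
  assumes "u \<le> n"
  shows "small_demand (suffix_requests n (ascending n x)) u = top_sum n u x"
proof -
  let ?a = "ascending n x"
  have "small_demand (suffix_requests n ?a) u = (\<Sum>t=1..n. if card {t..n} \<le> u then ?a ! (t - 1) else 0)"
    unfolding small_demand_def by (rule sum_list_suffix_requests)
  also have "\<dots> = (\<Sum>t\<in>{Suc (n - u)..n}. ?a ! (t - 1))"
    using assms by (intro sum.mono_neutral_cong_right) auto
  also have "\<dots> = (\<Sum>t<u. ?a ! (n - u + t))"
    using assms by (intro sum.reindex_bij_witness[of _ "\<lambda>t. Suc (n - u + t)" "\<lambda>t. t - 1 - (n - u)"]) auto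
  also have "\<dots> = sum_list (drop (n - u) ?a)"
    using assms by (simp add: sum_list_sum_nth atLeast0LessThan)
  finally show ?thesis by (simp add: top_sum_drop)
qed

lemma ascending_sorted_vector:
  "ascending n (\<lambda>i. if i \<in> {1..n} then ascending n x ! (i - 1) else 0) = ascending n x"
proof -
  have "map (\<lambda>i. if i \<in> {1..n} then ascending n x ! (i - 1) else 0) [1..<Suc n] =
      map (\<lambda>t. ascending n x ! (t - 1)) [1..<Suc n]"
    by (intro map_cong) auto
  then have "ascending n (\<lambda>i. if i \<in> {1..n} then ascending n x ! (i - 1) else 0) =
      sort (ascending n x)"
    by (simp only: map_nth_ascending ascending_def[of n "\<lambda>i. if i \<in> {1..n} then ascending n x ! (i - 1) else 0"])
  then show ?thesis by (simp add: sorted_sort_id)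
qed

text \<open>Serving each request entirely at its first node \<open>t\<close> gives top sums equal to
  the small demands, which bound the top sums of every allocation from below.\<close>

lemma OPT_suffix_requests:
  assumes "\<And>i. i \<in> {1..n} \<Longrightarrow> 0 \<le> x i"
  shows "OPT n (suffix_requests n (ascending n x)) =
    (\<lambda>i. if i \<in> {1..n} then ascending n x ! (i - 1) else 0)" (is "OPT n ?E = ?z")
proof -
  have nested: "?E \<in> nested_requests n n (\<Sum>i=1..n. x i)"
    by (rule suffix_requests_nested[OF assms refl])
  have "(\<lambda>i. \<Sum>t\<leftarrow>[1..<Suc n]. if i = t then ascending n x ! (t - 1) else 0) \<in> Delta_seq n ?E"
    unfolding suffix_requests_def
  proof (rule Delta_seq_map)
    fix t assume t: "t \<in> set [1..<Suc n]"
    have "0 \<le> ascending n x ! (t - 1)"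
      using t by (intro ascending_nth_nonneg[OF assms]) auto
    then show "(\<lambda>i. if i = t then ascending n x ! (t - 1) else 0) \<in> Delta n {t..n} (ascending n x ! (t - 1))"
      using t by (auto simp: Delta_def)
  qed
  also have "(\<lambda>i. \<Sum>t\<leftarrow>[1..<Suc n]. if i = t then ascending n x ! (t - 1) else 0) = ?z"
    by (auto simp: fun_eq_iff interv_sum_list_conv_sum_set_nat simp del: upt_Suc)
  finally have z: "?z \<in> Delta_seq n ?E" .
  show ?thesis
  proof (rule OPT_eq[OF _ z])
    show "?E \<in> requests n n (\<Sum>i=1..n. x i)" using nested by (simp add: nested_requests_def)
    fix y assume y: "y \<in> Delta_seq n ?E"
    have "top_sum n j ?z \<le> top_sum n j y" if "j \<in> {1..n}" for j
    proof -
      have "top_sum n j ?z = top_sum n j x"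
        by (simp only: top_sum_def ascending_sorted_vector)
      also have "\<dots> = small_demand ?E j"
        using that by (simp add: small_demand_suffix_requests)
      also have "\<dots> \<le> top_sum n j y"
        using small_demand_le_top_sum[OF nested y] that by simp
      finally show ?thesis .
    qed
    moreover have "(\<Sum>i=1..n. y i) = (\<Sum>i=1..n. ?z i)"
      unfolding Delta_seq_sum[OF y] Delta_seq_sum[OF z] by (rule refl)
    ultimately show "majorizes n y ?z"
      unfolding majorizes_def using Delta_seq_nonneg[OF y] Delta_seq_nonneg[OF z] by blast
  qed
qed

section \<open>Comparison of the water-filling loads\<close>

lemma sum_WF_suffix_requests:
  assumes "suffix_requests n a \<in> nested_requests n n q" "j \<le> n"
  shows "sum (WF n (suffix_requests n a)) {Suc (n - j)..n} =
    (\<Sum>(N, d)\<leftarrow>suffix_requests n a. d * (real j / real (max j (card N))))"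
  unfolding sum_WF_nested[OF assms(1) finite_atLeastAtMost] sum_list_suffix_requests
proof (intro sum.cong refl)
  fix t assume t: "t \<in> {1..n}"
  \<comment> \<open>Two final segments of \<open>{1..n}\<close> are comparable, so their
    intersection is the smaller one. This makes the bound of \<open>sum_WF_nested_le\<close> an
    equality.\<close>
  have "{Suc (n - j)..n} \<inter> {t..n} = {max (Suc (n - j)) t..n}" by auto
  moreover have "Suc n - max (Suc (n - j)) t = min j (Suc n - t)"
    using assms(2) t by (auto simp: max_def min_def)
  ultimately have "card ({Suc (n - j)..n} \<inter> {t..n}) = min j (Suc n - t)" by simp
  moreover have "real (min j (Suc n - t)) / real (Suc n - t) = real j / real (max j (Suc n - t))"
    using t by (auto simp: max_def min_def)
  ultimately show "a ! (t - 1) * (real (card ({Suc (n - j)..n} \<inter> {t..n})) / real (card {t..n})) =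
      a ! (t - 1) * (real j / real (max j (card {t..n})))"
    by simp
qed

lemma WF_suffix_requests_majorizes:
  assumes E: "E \<in> nested_requests n m q" and x: "x \<in> Delta_seq n E"
  shows "majorizes n (WF n (suffix_requests n (ascending n x))) (WF n E)"
proof -
  let ?E = "suffix_requests n (ascending n x)"
  have total: "(\<Sum>(N, d)\<leftarrow>E. d) = q" using E by (simp add: nested_requests_def requests_def)
  have E': "?E \<in> nested_requests n n q"
    using Delta_seq_nonneg[OF x] Delta_seq_sum[OF x] total by (intro suffix_requests_nested) auto
  have total': "(\<Sum>(N, d)\<leftarrow>?E. d) = q" using E' by (simp add: nested_requests_def requests_def)
  have card_le: "\<forall>(N, d)\<in>set F. card N \<le> n" if "F \<in> nested_requests n m' q" for F m'
  proof clarify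
    fix N d assume "(N, d) \<in> set F"
    then have "N \<subseteq> {1..n}" using that by (auto simp: nested_requests_def requests_def)
    then show "card N \<le> n" using card_mono[of "{1..n}" N] by simp
  qed
  show ?thesis unfolding majorizes_iff_hinge
  proof (intro conjI ballI allI)
    show "0 \<le> WF n ?E i" "0 \<le> WF n E i" for i
      using WF_nested_nonneg E E' by blast+
    show "(\<Sum>i=1..n. WF n ?E i) = (\<Sum>i=1..n. WF n E i)"
      unfolding WF_nested_total[OF E] WF_nested_total[OF E'] by (rule refl)
    fix k
    \<comment> \<open>A set realizing the hinge sum of \<open>WF n E\<close> is compared with the
      last \<open>j\<close> nodes under \<open>WF n ?E\<close>, where \<open>j\<close> is its
      size.\<close>
    obtain S where S: "S \<subseteq> {1..n}" "hinge n k (WF n E) = sum (WF n E) S - real (card S) * k"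
      using hinge_attained by blast
    define j where "j = card S"
    define w where "w s = real j / real (max j s)" for s
    have j: "j \<le> n" unfolding j_def using card_mono[OF _ S(1)] by simp
    \<comment> \<open>Antitone weights make the Abel coefficients nonnegative, so the inequality
      between small demands passes to the weighted sums.\<close>
    have "w (Suc u) \<le> w u" for u
      unfolding w_def by (cases "j = 0") (auto intro!: divide_left_mono)
    then have mono: "(w u - w (Suc u)) * small_demand E u \<le> (w u - w (Suc u)) * small_demand ?E u"
      if "u < n" for u
      using that small_demand_le_top_sum[OF E x, of u]
      by (intro mult_left_mono) (auto simp: small_demand_suffix_requests)
    have "sum (WF n E) S \<le> (\<Sum>(N, d)\<leftarrow>E. d * w (card N))"
      unfolding w_def j_def using S(1) finite_subset by (intro sum_WF_nested_le[OF E]) blast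
    also have "\<dots> = w n * q + (\<Sum>u<n. (w u - w (Suc u)) * small_demand E u)"
      by (simp add: weighted_demand[OF card_le[OF E]] total)
    also have "\<dots> \<le> w n * q + (\<Sum>u<n. (w u - w (Suc u)) * small_demand ?E u)"
      using mono by (auto intro!: sum_mono)
    also have "\<dots> = (\<Sum>(N, d)\<leftarrow>?E. d * w (card N))"
      by (simp add: weighted_demand[OF card_le[OF E']] total')
    also have "\<dots> = sum (WF n ?E) {Suc (n - j)..n}"
      unfolding w_def by (rule sum_WF_suffix_requests[OF E' j, symmetric])
    also have "\<dots> \<le> real (card {Suc (n - j)..n}) * k + hinge n k (WF n ?E)"
      by (rule sum_le_hinge) auto
    also have "card {Suc (n - j)..n} = card S" using j by (simp add: j_def)
    finally show "hinge n k (WF n E) \<le> hinge n k (WF n ?E)" using S(2) by simp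
  qed
qed

theorem theorem3:
  fixes n m :: nat and q :: real and E E' :: "request list"
  assumes "E \<in> nested_requests n m q"
    and "E' = map (\<lambda>t. ({t..n}, ascending n (OPT n E) ! (t - 1))) [1..<Suc n]"
  shows "(E' \<in> nested_requests n n q \<and> (\<forall>t\<in>{1..n}. fst (E' ! (t - 1)) = {t..n}))
       \<and> (sorted (map snd E') \<and> (\<Sum>t=1..n. snd (E' ! (t - 1))) = q)
       \<and> (maj_equiv n (OPT n E) (OPT n E') \<and> majorizes n (WF n E') (WF n E))"
proof -
  let ?o = "OPT n E"
  have E': "E' = suffix_requests n (ascending n ?o)"
    using assms(2) by (simp only: suffix_requests_def)
  have o: "?o \<in> Delta_seq n E" by (rule OPT_in_Delta_seq[OF assms(1)])
  have nonneg: "0 \<le> ?o i" for i by (rule Delta_seq_nonneg[OF o])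
  have total: "(\<Sum>i=1..n. ?o i) = q"
    using Delta_seq_sum[OF o] assms(1) by (simp add: nested_requests_def requests_def)
  have nth: "E' ! (t - 1) = ({t..n}, ascending n ?o ! (t - 1))" if "t \<in> {1..n}" for t
    using that by (auto simp: E' suffix_requests_def simp del: upt_Suc)
  have nested: "E' \<in> nested_requests n n q"
    unfolding E' using nonneg total by (intro suffix_requests_nested)
  have snds: "map snd E' = ascending n ?o"
    unfolding E' suffix_requests_def map_map comp_def snd_conv by (rule map_nth_ascending)
  have "(\<Sum>t=1..n. snd (E' ! (t - 1))) = (\<Sum>(N, d)\<leftarrow>E'. d)"
    unfolding E' sum_list_suffix_requests using nth by (intro sum.cong) (auto simp: E')
  then have sum_q: "(\<Sum>t=1..n. snd (E' ! (t - 1))) = q"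
    using nested by (simp add: nested_requests_def requests_def)
  \<comment> \<open>\<open>OPT n E'\<close> is the increasing rearrangement of
    \<open>OPT n E\<close>, so all top sums agree and majorization holds both ways.\<close>
  have asc: "ascending n (OPT n E') = ascending n ?o"
    unfolding E' OPT_suffix_requests[OF nonneg] by (rule ascending_sorted_vector)
  have o': "OPT n E' \<in> Delta_seq n E'" by (rule OPT_in_Delta_seq[OF nested])
  have "(\<Sum>i=1..n. OPT n E' i) = q"
    using Delta_seq_sum[OF o'] nested by (simp add: nested_requests_def requests_def)
  then have "maj_equiv n ?o (OPT n E')"
    using nonneg Delta_seq_nonneg[OF o'] total asc
    by (simp add: maj_equiv_def majorizes_def top_sum_def)
  moreover have "majorizes n (WF n E') (WF n E)"
    unfolding E' by (rule WF_suffix_requests_majorizes[OF assms(1) o])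
  ultimately show ?thesis using nested nth snds sum_q by simp
qed

end
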